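(* Let $q\in[1,\infty)$, let $X=\ell_\infty^2$ (that is, $\mathbb{R}^2$ with the norm $\|(x_1,x_2)\|=\max\{|x_1|,|x_2|\}$), and let $\lambda_q(a,b)=2^{-1/q}(a^q+b^q)^{1/q}$ for $a,b\ge0$. Then $$\mathfrak{C}_{\lambda_q,q}(\ell_\infty^2)=2^{1-1/q}.$$
   Context: For a real normed space $X$ with unit sphere $S_X$, a continuous function $\lambda:[0,\infty)^2\to[0,\infty)$ homogeneous of degree one with $\lambda(1,1)=1$, and $p\in[1,\infty)$, $$\mathfrak{C}_{\lambda,p}(X)=\sup\{\lambda(\|ru+sv\|,\|su-rv\|):u,v\in S_X,\ r,s\ge0,\ \|(r,s)\|_p=1\},$$ where $\|(r,s)\|_p=(|r|^p+|s|^p)^{1/p}$. *)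

theory Defs
  imports "HOL-Analysis.Analysis"
begin

text \<open>A separate copy of the plane is needed because \<^typ>\<open>real \<times> real\<close> already carries the Euclidean norm.\<close>

datatype linf2 = Linf2 (coord1: real) (coord2: real)

instantiation linf2 :: real_normed_vector
begin

definition zero_linf2 :: linf2 where
  "0 = Linf2 0 0"

definition plus_linf2 :: "linf2 \<Rightarrow> linf2 \<Rightarrow> linf2" where
  "x + y = Linf2 (coord1 x + coord1 y) (coord2 x + coord2 y)"

definition uminus_linf2 :: "linf2 \<Rightarrow> linf2" where
  "- x = Linf2 (- coord1 x) (- coord2 x)"

definition minus_linf2 :: "linf2 \<Rightarrow> linf2 \<Rightarrow> linf2" where
  "x - y = Linf2 (coord1 x - coord1 y) (coord2 x - coord2 y)"

definition scaleR_linf2 :: "real \<Rightarrow> linf2 \<Rightarrow> linf2" where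
  "c *\<^sub>R x = Linf2 (c * coord1 x) (c * coord2 x)"

definition norm_linf2 :: "linf2 \<Rightarrow> real" where
  "norm x = max \<bar>coord1 x\<bar> \<bar>coord2 x\<bar>"

definition sgn_linf2 :: "linf2 \<Rightarrow> linf2" where
  "sgn (x::linf2) = inverse (norm x) *\<^sub>R x"

definition dist_linf2 :: "linf2 \<Rightarrow> linf2 \<Rightarrow> real" where
  "dist (x::linf2) y = norm (x - y)"

definition uniformity_linf2 :: "(linf2 \<times> linf2) filter" where
  "(uniformity :: (linf2 \<times> linf2) filter) = (INF e\<in>{0 <..}. principal {(x, y). dist x y < e})"

definition open_linf2 :: "linf2 set \<Rightarrow> bool" where
  "open (U :: linf2 set) \<longleftrightarrow> (\<forall>x\<in>U. eventually (\<lambda>(x', y). x' = x \<longrightarrow> y \<in> U) uniformity)"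

instance
proof
  fix x y :: linf2 and a :: real
  show "norm (x + y) \<le> norm x + norm y"
    by (auto simp: norm_linf2_def plus_linf2_def)
  show "norm (a *\<^sub>R x) = \<bar>a\<bar> * norm x"
    by (simp add: norm_linf2_def scaleR_linf2_def abs_mult max_mult_distrib_left)
  show "(norm x = 0) = (x = 0)"
    by (cases x) (auto simp: norm_linf2_def zero_linf2_def max_def)
qed (auto simp: zero_linf2_def plus_linf2_def uminus_linf2_def minus_linf2_def scaleR_linf2_def
      sgn_linf2_def dist_linf2_def uniformity_linf2_def open_linf2_def algebra_simps)

end

definition pnorm2 :: "real \<Rightarrow> real \<Rightarrow> real \<Rightarrow> real" where
  "pnorm2 p r s = (\<bar>r\<bar> powr p + \<bar>s\<bar> powr p) powr (1 / p)"

text \<open>The functions \<open>\<lambda> : [0, \<infinity>)\<^sup>2 \<rightarrow> [0, \<infinity>)\<close> for which the constant is considered; values at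
  negative arguments are irrelevant.\<close>

definition admissible :: "(real \<Rightarrow> real \<Rightarrow> real) \<Rightarrow> bool" where
  "admissible L \<longleftrightarrow>
     (\<forall>a\<ge>0. \<forall>b\<ge>0. L a b \<ge> 0) \<and>
     continuous_on ({0..} \<times> {0..}) (\<lambda>(a, b). L a b) \<and>
     (\<forall>t\<ge>0. \<forall>a\<ge>0. \<forall>b\<ge>0. L (t * a) (t * b) = t * L a b) \<and>
     L 1 1 = 1"

definition C_set :: "(real \<Rightarrow> real \<Rightarrow> real) \<Rightarrow> real \<Rightarrow> 'a::real_normed_vector itself \<Rightarrow> real set" where
  "C_set L p X =
     {L (norm (r *\<^sub>R u + s *\<^sub>R v)) (norm (s *\<^sub>R u - r *\<^sub>R v)) | (u::'a) (v::'a) r s.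
        norm u = 1 \<and> norm v = 1 \<and> r \<ge> 0 \<and> s \<ge> 0 \<and> pnorm2 p r s = 1}"

text \<open>The supremum of a set of reals is meaningful only for nonempty sets bounded above.
  Boundedness is \<open>bdd_above_C_set\<close> below; the set is nonempty as soon as the space is nontrivial.\<close>

definition C_const :: "(real \<Rightarrow> real \<Rightarrow> real) \<Rightarrow> real \<Rightarrow> 'a::real_normed_vector itself \<Rightarrow> real" where
  "C_const L p X = Sup (C_set L p X)"

definition lambda_mean :: "real \<Rightarrow> real \<Rightarrow> real \<Rightarrow> real" where
  "lambda_mean q a b = 2 powr (- 1 / q) * (a powr q + b powr q) powr (1 / q)"

lemma bdd_above_C_set:
  assumes L: "admissible L" and p: "p \<ge> 1"
  shows "bdd_above (C_set L p TYPE('a::real_normed_vector))"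
proof -
  have cont: "continuous_on ({0..2} \<times> {0..2}) (\<lambda>(a, b). L a b)"
    using L unfolding admissible_def by (auto intro: continuous_on_subset)
  have "compact ({0..2::real} \<times> {0..2::real})"
    by (intro compact_Times compact_Icc)
  then have "bdd_above ((\<lambda>(a, b). L a b) ` ({0..2} \<times> {0..2}))"
    using cont by (intro bounded_imp_bdd_above compact_imp_bounded compact_continuous_image)
  moreover have "C_set L p TYPE('a) \<subseteq> (\<lambda>(a, b). L a b) ` ({0..2} \<times> {0..2})"
  proof
    fix y assume "y \<in> C_set L p TYPE('a)"
    then obtain u v :: 'a and r s where
      y: "y = L (norm (r *\<^sub>R u + s *\<^sub>R v)) (norm (s *\<^sub>R u - r *\<^sub>R v))"
      and uv: "norm u = 1" "norm v = 1" and rs: "r \<ge> 0" "s \<ge> 0" and n: "pnorm2 p r s = 1"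
      unfolding C_set_def by blast
    have "((r powr p + s powr p) powr (1 / p)) powr p = 1"
      using n rs by (simp add: pnorm2_def)
    then have sum1: "r powr p + s powr p = 1"
      using p by (simp add: powr_powr)
    have le1: "t \<le> 1" if "t \<ge> 0" "t powr p \<le> 1" for t :: real
    proof (rule ccontr)
      assume "\<not> t \<le> 1"
      then have "1 powr p < t powr p"
        using p by (intro powr_less_mono2) auto
      then show False using that by simp
    qed
    have "r powr p \<le> 1" "s powr p \<le> 1"
      using sum1 powr_ge_zero[of r p] powr_ge_zero[of s p] by linarith+
    then have rs1: "r \<le> 1" "s \<le> 1"
      using le1 rs by auto
    have "norm (r *\<^sub>R u + s *\<^sub>R v) \<le> 2" "norm (s *\<^sub>R u - r *\<^sub>R v) \<le> 2"
      using norm_triangle_ineq[of "r *\<^sub>R u" "s *\<^sub>R v"] norm_triangle_ineq4[of "s *\<^sub>R u" "r *\<^sub>R v"]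
        uv rs rs1 by auto
    then show "y \<in> (\<lambda>(a, b). L a b) ` ({0..2} \<times> {0..2})"
      unfolding y by (intro image_eqI[where x = "(_, _)"]) auto
  qed
  ultimately show ?thesis
    by (rule bdd_above_mono)
qed

lemma admissible_lambda_mean:
  assumes q: "q \<ge> 1"
  shows "admissible (lambda_mean q)"
proof -
  have "continuous_on ({0..} \<times> {0..}) (\<lambda>z::real \<times> real.
      2 powr (- 1 / q) * (fst z powr q + snd z powr q) powr (1 / q))"
    using q by (intro continuous_intros continuous_on_powr') auto
  moreover have "lambda_mean q (t * a) (t * b) = t * lambda_mean q a b"
    if "t \<ge> 0" "a \<ge> 0" "b \<ge> 0" for t a b
  proof -
    have "((t * a) powr q + (t * b) powr q) powr (1 / q)
        = (t powr q * (a powr q + b powr q)) powr (1 / q)"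
      using that by (simp add: powr_mult algebra_simps)
    also have "\<dots> = t * (a powr q + b powr q) powr (1 / q)"
      using that q by (simp add: powr_mult powr_powr)
    finally show ?thesis
      by (simp add: lambda_mean_def)
  qed
  moreover have "lambda_mean q 1 1 = 1"
    by (simp add: lambda_mean_def flip: powr_add)
  ultimately show ?thesis
    by (auto simp: admissible_def lambda_mean_def case_prod_unfold)
qed

end

theory Submission
  imports Defs
begin

text \<open>Both norms in the definition of the constant are at most \<open>r + s\<close>, and convexity of the
  \<open>q\<close>-th power gives \<open>2 (r + s)\<^sup>q \<le> 2\<^sup>q (r\<^sup>q + s\<^sup>q) = 2\<^sup>q\<close>, in every normed space. In
  \<open>\<ell>\<^sub>\<infinity>\<^sup>2\<close> the bound is attained at \<open>u = (1, 1)\<close>, \<open>v = (1, -1)\<close>, \<open>r = s = 2\<^bsup>-1/q\<^esup>\<close>,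
  where both norms equal \<open>r + s\<close>.\<close>

lemma add_powr_le:
  fixes r s q :: real
  assumes "q \<ge> 1" "r \<ge> 0" "s \<ge> 0"
  shows "2 * (r + s) powr q \<le> 2 powr q * (r powr q + s powr q)"
\<comment> \<open>If an argument vanishes, \<open>0 powr q = 0\<close> leaves only
  \<open>2 \<le> 2 powr q\<close>; otherwise convexity is applied at positive points.\<close>
proof (cases "r = 0 \<or> s = 0")
  case True
  have "2 powr 1 \<le> (2 powr q :: real)"
    using assms by (intro powr_mono) auto
  then show ?thesis
    using True by (auto intro!: mult_right_mono)
next
  case False
  \<comment> \<open>Convexity at the midpoint; scaling by \<open>2 * 2 powr q\<close> then gives the
    claim.\<close>
  have "((1 - 1/2) *\<^sub>R r + (1/2) *\<^sub>R s) powr q \<le> (1 - 1/2) * r powr q + (1/2) * s powr q"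
    using assms False by (intro convex_onD[OF powr_convex]) auto
  then have "((r + s) / 2) powr q \<le> (r powr q + s powr q) / 2"
    by (simp add: add_divide_distrib)
  then show ?thesis
    using assms by (simp add: powr_divide field_simps)
qed

lemma pnorm2_eq_1D:
  assumes "p \<ge> 1" "r \<ge> 0" "s \<ge> 0" "pnorm2 p r s = 1"
  shows "r powr p + s powr p = 1"
proof -
  have "((r powr p + s powr p) powr (1 / p)) powr p = 1"
    using assms by (simp add: pnorm2_def)
  then show ?thesis
    using assms by (simp add: powr_powr)
qed

text \<open>Taking the \<open>q\<close>-th root turns the hypothesis into the bound 2, which the
  normalising factor \<open>2 powr (- 1 / q)\<close> then scales.\<close>

lemma lambda_mean_le:
  assumes q: "q \<ge> 1" and "a \<ge> 0" "b \<ge> 0" and le: "a powr q + b powr q \<le> 2 powr q"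
  shows "lambda_mean q a b \<le> 2 powr (1 - 1 / q)"
proof -
  have "(a powr q + b powr q) powr (1 / q) \<le> (2 powr q) powr (1 / q)"
    using q le by (intro powr_mono2) auto
  then have "(a powr q + b powr q) powr (1 / q) \<le> 2"
    using q by (simp add: powr_powr)
  then have "lambda_mean q a b \<le> 2 powr (- 1 / q) * 2"
    unfolding lambda_mean_def by (intro mult_left_mono) auto
  also have "\<dots> = 2 powr (1 - 1 / q)"
    by (simp add: powr_diff powr_minus_divide)
  finally show ?thesis .
qed

text \<open>Homogeneity pulls \<open>t\<close> out of the value 1 at \<open>(1, 1)\<close>.\<close>

lemma lambda_mean_diag:
  assumes "q \<ge> 1" "t \<ge> 0"
  shows "lambda_mean q t t = t"
  using admissible_lambda_mean[OF assms(1)] assms(2)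
  unfolding admissible_def by (metis mult.right_neutral zero_le_one)

text \<open>The upper half of the theorem: the geometry of the space enters only through the
  triangle inequality.\<close>

lemma C_set_lambda_mean_le:
  assumes q: "q \<ge> 1" and y: "y \<in> C_set (lambda_mean q) q TYPE('a::real_normed_vector)"
  shows "y \<le> 2 powr (1 - 1 / q)"
proof -
  obtain u v :: 'a and r s where
    y: "y = lambda_mean q (norm (r *\<^sub>R u + s *\<^sub>R v)) (norm (s *\<^sub>R u - r *\<^sub>R v))"
    and uv: "norm u = 1" "norm v = 1" and rs: "r \<ge> 0" "s \<ge> 0" and n: "pnorm2 q r s = 1"
    using y unfolding C_set_def by blast
  have "norm (r *\<^sub>R u + s *\<^sub>R v) \<le> r + s" "norm (s *\<^sub>R u - r *\<^sub>R v) \<le> r + s"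
    using norm_triangle_ineq[of "r *\<^sub>R u" "s *\<^sub>R v"] norm_triangle_ineq4[of "s *\<^sub>R u" "r *\<^sub>R v"]
      uv rs by auto
  then have "norm (r *\<^sub>R u + s *\<^sub>R v) powr q \<le> (r + s) powr q"
    "norm (s *\<^sub>R u - r *\<^sub>R v) powr q \<le> (r + s) powr q"
    using q by (auto intro: powr_mono2)
  with add_powr_le[OF q rs] pnorm2_eq_1D[OF q rs n]
  have "norm (r *\<^sub>R u + s *\<^sub>R v) powr q + norm (s *\<^sub>R u - r *\<^sub>R v) powr q \<le> 2 powr q"
    by simp
  then show ?thesis
    unfolding y using q by (intro lambda_mean_le) auto
qed

theorem proposition21:
  fixes q :: real
  assumes "q \<ge> 1"
  shows "C_const (lambda_mean q) q TYPE(linf2) = 2 powr (1 - 1 / q)"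
proof -
  \<comment> \<open>Adjacent corners of the unit square: \<open>u + v\<close> and
    \<open>u - v\<close> lie on the coordinate axes, both with norm 2.\<close>
  define u v where "u = Linf2 1 1" and "v = Linf2 1 (- 1)"
  \<comment> \<open>Equal weights give equality in the convexity bound; the constraint then forces
    \<open>r powr q = 1/2\<close>.\<close>
  define r :: real where "r = 2 powr (- 1 / q)"
  have r: "r \<ge> 0" "2 * r = 2 powr (1 - 1 / q)"
    by (simp_all add: r_def powr_diff powr_minus_divide)
  have uv: "norm u = 1" "norm v = 1"
    by (simp_all add: u_def v_def norm_linf2_def)
  have "r powr q = 2 powr (- 1)"
    using assms unfolding r_def powr_powr by simp
  then have "r powr q + r powr q = 1"
    by simp
  then have "pnorm2 q r r = 1"
    using r by (simp add: pnorm2_def)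
  moreover have "norm (r *\<^sub>R u + r *\<^sub>R v) = 2 * r" "norm (r *\<^sub>R u - r *\<^sub>R v) = 2 * r"
    using r(1)
    by (simp_all add: u_def v_def norm_linf2_def plus_linf2_def minus_linf2_def scaleR_linf2_def)
  moreover have "lambda_mean q (2 * r) (2 * r) = 2 * r"
    using assms r(1) by (intro lambda_mean_diag) auto
  ultimately have "2 powr (1 - 1 / q) \<in> C_set (lambda_mean q) q TYPE(linf2)"
    unfolding C_set_def using uv r by (intro CollectI exI[of _ u] exI[of _ v] exI[of _ r]) auto
  \<comment> \<open>The upper bound belongs to the set, so it is the maximum and hence the
    supremum.\<close>
  then show ?thesis
    unfolding C_const_def by (intro cSup_eq_maximum C_set_lambda_mean_le assms)
qed

end
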